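(* Let $1\le c\le 6$, let $n\ge c+2$ be an integer, let $\alpha$ be a real number with $\alpha\neq 0,1$, and let $G$ be a $c$-cyclic graph on $n$ vertices with vertex degrees $d_1,\dots,d_n$. Put $M_1^{\alpha}(G)=\sum_{i=1}^n d_i^{\alpha}$. Define $L_c$ and a finite set $U_c$ of real numbers as follows. $L_1=n\,2^{\alpha}$; $U_1=\{(n-1)^{\alpha}+2^{\alpha+1}+(n-3)\}$. $L_2=2\cdot 3^{\alpha}+2^{\alpha}(n-2)$; $U_2=\{(n-1)^{\alpha}+3^{\alpha}+2^{\alpha+1}+(n-4)\}$. $L_3=4\cdot 3^{\alpha}+2^{\alpha}(n-4)$; $U_3=\{(n-1)^{\alpha}+4^{\alpha}+3\cdot 2^{\alpha}+(n-5),\ (n-1)^{\alpha}+3^{\alpha+1}+(n-4)\}$. $L_4=2\cdot 3^{\alpha+1}+2^{\alpha}(n-6)$; $U_4=\{(n-1)^{\alpha}+5^{\alpha}+2^{\alpha+2}+(n-6),\ (n-1)^{\alpha}+2^{\alpha}(2^{\alpha}+1)+2\cdot 3^{\alpha}+(n-5)\}$. $L_5=8\cdot 3^{\alpha}+2^{\alpha}(n-8)$; $U_5=\{(n-1)^{\alpha}+6^{\alpha}+5\cdot 2^{\alpha}+(n-7),\ (n-1)^{\alpha}+5^{\alpha}+2\cdot 3^{\alpha}+2\cdot 2^{\alpha}+(n-6),\ (n-1)^{\alpha}+2^{2\alpha+1}+2\cdot 3^{\alpha}+(n-5)\}$. $L_6=10\cdot 3^{\alpha}+2^{\alpha}(n-10)$;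 $U_6=\{(n-1)^{\alpha}+7^{\alpha}+6\cdot 2^{\alpha}+(n-8),\ (n-1)^{\alpha}+6^{\alpha}+2\cdot 3^{\alpha}+3\cdot 2^{\alpha}+(n-7),\ (n-1)^{\alpha}+5^{\alpha}+4^{\alpha}+2\cdot 3^{\alpha}+2^{\alpha}+(n-6),\ (n-1)^{\alpha}+2^{2\alpha+2}+(n-5)\}$. If $\alpha<0$ or $\alpha>1$, then $$L_c\le M_1^{\alpha}(G)\le \max U_c .$$ If $0<\alpha<1$, the bounds are reversed: $$\min U_c\le M_1^{\alpha}(G)\le L_c .$$
   Context: All graphs are finite, simple, connected and undirected. A graph with $n$ vertices and $m$ edges is $c$-cyclic if $c=m-n+1$. $M_1^{\alpha}$ is called the first general Zagreb index. *)

theory Defs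
  imports Complex_Main "Graph_Theory.Graph_Theory"
begin

text \<open>A finite simple undirected graph is a \<^locale>\<open>pair_graph\<close>: a finite vertex set together with a
  finite, symmetric, irreflexive set of arcs. Each undirected edge \<open>{u, v}\<close> thus gives the two
  arcs \<open>(u, v)\<close> and \<open>(v, u)\<close>, so the number of edges is not \<open>card (parcs G)\<close>, and the degree of a
  vertex is its out-degree.\<close>

definition undirected_edges :: "'a pair_pre_digraph \<Rightarrow> 'a set set" where
  "undirected_edges G = {{u, v} | u v. (u, v) \<in> parcs G}"

text \<open>\<open>Digraph_Component.connected\<close> is qualified because \<open>connected\<close> is also the name of the
  topological notion.\<close>

definition connected_simple_graph :: "'a pair_pre_digraph \<Rightarrow> bool" where
  "connected_simple_graph G \<longleftrightarrow> pair_graph G \<and> Digraph_Component.connected (with_proj G)"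

definition c_cyclic :: "nat \<Rightarrow> 'a pair_pre_digraph \<Rightarrow> bool" where
  "c_cyclic c G \<longleftrightarrow> int c = int (card (undirected_edges G)) - int (card (pverts G)) + 1"

definition first_general_zagreb :: "real \<Rightarrow> 'a pair_pre_digraph \<Rightarrow> real" where
  "first_general_zagreb \<alpha> G = (\<Sum>v\<in>pverts G. real (out_degree (with_proj G) v) powr \<alpha>)"

definition L_bound :: "nat \<Rightarrow> nat \<Rightarrow> real \<Rightarrow> real" where
  "L_bound c n \<alpha> =
    (if c = 1 then real n * 2 powr \<alpha>
     else if c = 2 then 2 * 3 powr \<alpha> + 2 powr \<alpha> * (real n - 2)
     else if c = 3 then 4 * 3 powr \<alpha> + 2 powr \<alpha> * (real n - 4)
     else if c = 4 then 2 * 3 powr (\<alpha> + 1) + 2 powr \<alpha> * (real n - 6)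
     else if c = 5 then 8 * 3 powr \<alpha> + 2 powr \<alpha> * (real n - 8)
     else if c = 6 then 10 * 3 powr \<alpha> + 2 powr \<alpha> * (real n - 10)
     else undefined)"

definition U_set :: "nat \<Rightarrow> nat \<Rightarrow> real \<Rightarrow> real set" where
  "U_set c n \<alpha> =
    (if c = 1 then
       {(real n - 1) powr \<alpha> + 2 powr (\<alpha> + 1) + (real n - 3)}
     else if c = 2 then
       {(real n - 1) powr \<alpha> + 3 powr \<alpha> + 2 powr (\<alpha> + 1) + (real n - 4)}
     else if c = 3 then
       {(real n - 1) powr \<alpha> + 4 powr \<alpha> + 3 * 2 powr \<alpha> + (real n - 5),
        (real n - 1) powr \<alpha> + 3 powr (\<alpha> + 1) + (real n - 4)}
     else if c = 4 then
       {(real n - 1) powr \<alpha> + 5 powr \<alpha> + 2 powr (\<alpha> + 2) + (real n - 6),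
        (real n - 1) powr \<alpha> + 2 powr \<alpha> * (2 powr \<alpha> + 1) + 2 * 3 powr \<alpha> + (real n - 5)}
     else if c = 5 then
       {(real n - 1) powr \<alpha> + 6 powr \<alpha> + 5 * 2 powr \<alpha> + (real n - 7),
        (real n - 1) powr \<alpha> + 5 powr \<alpha> + 2 * 3 powr \<alpha> + 2 * 2 powr \<alpha> + (real n - 6),
        (real n - 1) powr \<alpha> + 2 powr (2 * \<alpha> + 1) + 2 * 3 powr \<alpha> + (real n - 5)}
     else if c = 6 then
       {(real n - 1) powr \<alpha> + 7 powr \<alpha> + 6 * 2 powr \<alpha> + (real n - 8),
        (real n - 1) powr \<alpha> + 6 powr \<alpha> + 2 * 3 powr \<alpha> + 3 * 2 powr \<alpha> + (real n - 7),
        (real n - 1) powr \<alpha> + 5 powr \<alpha> + 4 powr \<alpha> + 2 * 3 powr \<alpha> + 2 powr \<alpha> + (real n - 6),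
        (real n - 1) powr \<alpha> + 2 powr (2 * \<alpha> + 2) + (real n - 5)}
     else undefined)"

end

theory Submission
  imports Defs "HOL-Analysis.Convex"
begin

text \<open>The lower bound is the discrete tangent line at 2 of the convex sequence \<open>k\<^sup>\<alpha>\<close> (of \<open>-k\<^sup>\<alpha>\<close> when
  \<open>0 < \<alpha> < 1\<close>), since the degree sum is \<open>2 (n - 1 + c)\<close>.

  For the upper bound, let \<open>v\<close> have maximum degree and move the neighbours of another vertex \<open>u\<close> that
  lie outside the closed neighbourhood of \<open>v\<close> from \<open>u\<close> to \<open>v\<close>. The degree sequence spreads out, so
  by convexity the sum does not decrease, and if \<open>u\<close> is adjacent to \<open>v\<close> the graph stays connected.
  Iterating makes \<open>v\<close> a dominating vertex. Deleting it leaves a graph with \<open>c\<close> edges on \<open>n - 1\<close>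
  vertices, to which the same argument applies recursively, now without connectivity and with \<open>v\<close>
  dominating only its non-isolated part. The successive sizes of the neighbourhoods form a partition
  of \<open>c\<close> into distinct parts, and for \<open>c \<le> 6\<close> these partitions are exactly the members of \<open>U\<^sub>c\<close>.\<close>

section \<open>Convex sequences\<close>

definition convex_seq :: "(nat \<Rightarrow> real) \<Rightarrow> bool" where
  "convex_seq g \<longleftrightarrow> (\<forall>k. 2 * g (Suc k) \<le> g k + g (Suc (Suc k)))"

lemma convex_seq_Suc: "convex_seq g \<Longrightarrow> convex_seq (\<lambda>k. g (Suc k))"
  by (simp add: convex_seq_def)

lemma convex_seq_diff_mono:
  assumes "convex_seq g" "i \<le> j"
  shows "g (Suc i) - g i \<le> g (Suc j) - g j"
proof -
  have "g (Suc k) - g k \<le> g (Suc (Suc k)) - g (Suc k)" for k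
    using assms(1) unfolding convex_seq_def by (smt (verit))
  then show ?thesis
    using lift_Suc_mono_le[of "\<lambda>k. g (Suc k) - g k"] assms(2) by blast
qed

text \<open>Every unit step of the spreading gains an increment of \<open>g\<close> at or above
  \<open>a\<close> and loses one below \<open>b\<close>, and increments of a convex sequence
  grow.\<close>

lemma convex_seq_spread:
  assumes "convex_seq g" "b \<le> a" "k \<le> b"
  shows "g a + g b \<le> g (a + k) + g (b - k)"
  using assms(3)
proof (induction k)
  case (Suc k)
  have "g (Suc (b - Suc k)) - g (b - Suc k) \<le> g (Suc (a + k)) - g (a + k)"
    using assms Suc.prems by (intro convex_seq_diff_mono) auto
  moreover have "Suc (b - Suc k) = b - k"
    using Suc.prems by auto
  ultimately show ?case
    using Suc by simp
qed simp

text \<open>Moving away from \<open>m\<close>, increments to the right are at least the one at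
  \<open>m\<close> and those to the left at most that; hence one induction in each
  direction.\<close>

lemma convex_seq_tangent:
  assumes "convex_seq g"
  shows "g m + (real k - real m) * (g (Suc m) - g m) \<le> g k"
proof (cases "m \<le> k")
  case True
  then show ?thesis
  proof (induction k rule: dec_induct)
    case (step k)
    then show ?case
      using convex_seq_diff_mono[OF assms, of m k] by (simp add: algebra_simps)
  qed simp
next
  case False
  then have "k \<le> m" by simp
  then show ?thesis
  proof (induction k rule: inc_induct)
    case (step k)
    then show ?case
      using convex_seq_diff_mono[OF assms, of k m] by (simp add: algebra_simps)
  qed simp
qed

section \<open>Graphs as symmetric relations\<close>

text \<open>The explicit vertex set lets the recursion pass to induced subgraphs and still count
  isolated vertices. Each edge is two pairs, so \<open>card R\<close> is twice the number of
  edges.\<close>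

definition simple_on :: "'a set \<Rightarrow> 'a rel \<Rightarrow> bool" where
  "simple_on V R \<longleftrightarrow> finite V \<and> R \<subseteq> V \<times> V \<and> sym R \<and> irrefl R"

definition deg :: "'a rel \<Rightarrow> 'a \<Rightarrow> nat" where
  "deg R v = card (R `` {v})"

lemma simple_on_finite_nbs: "simple_on V R \<Longrightarrow> finite (R `` {v})"
  by (rule finite_subset[of _ V]) (auto simp: simple_on_def)

lemma simple_on_finite: "simple_on V R \<Longrightarrow> finite R"
  unfolding simple_on_def by (meson finite_SigmaI finite_subset)

lemma deg_le_card: "simple_on V R \<Longrightarrow> deg R v \<le> card V"
  unfolding deg_def by (rule card_mono) (auto simp: simple_on_def)

lemma sum_deg:
  assumes "simple_on V R"
  shows "(\<Sum>v\<in>V. deg R v) = card R"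
proof -
  have "R = Sigma V (\<lambda>v. R `` {v})"
    using assms by (auto simp: simple_on_def)
  then have "card R = card (Sigma V (\<lambda>v. R `` {v}))" by simp
  also have "\<dots> = (\<Sum>v\<in>V. deg R v)"
    using assms simple_on_finite_nbs[OF assms] by (simp add: deg_def simple_on_def)
  finally show ?thesis ..
qed

section \<open>Moving neighbours from one vertex to another\<close>

definition private_nbs :: "'a rel \<Rightarrow> 'a \<Rightarrow> 'a \<Rightarrow> 'a set" where
  "private_nbs R u v = R `` {u} - insert v (R `` {v})"

text \<open>This is the Kelmans transformation, also called compression. As \<open>v\<close> is not
  in \<open>X\<close>, an edge between \<open>u\<close> and \<open>v\<close> survives.\<close>

definition shift :: "'a rel \<Rightarrow> 'a \<Rightarrow> 'a \<Rightarrow> 'a rel" where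
  "shift R u v = (let X = private_nbs R u v in
     (R - {u} \<times> X - X \<times> {u}) \<union> {v} \<times> X \<union> X \<times> {v})"

lemma simple_on_shift:
  assumes "simple_on V R" "v \<in> V"
  shows "simple_on V (shift R u v)"
  using assms unfolding simple_on_def shift_def Let_def private_nbs_def
  by (auto simp: sym_def irrefl_def)

lemma deg_shift:
  assumes "simple_on V R" "u \<noteq> v"
  shows "deg (shift R u v) v = deg R v + card (private_nbs R u v)"
    and "deg (shift R u v) u = deg R u - card (private_nbs R u v)"
    and "card (private_nbs R u v) \<le> deg R u"
    and "w \<noteq> u \<Longrightarrow> w \<noteq> v \<Longrightarrow> deg (shift R u v) w = deg R w"
proof -
  let ?X = "private_nbs R u v"
  note fin = simple_on_finite_nbs[OF assms(1)]
  have sym: "(x, y) \<in> R \<Longrightarrow> (y, x) \<in> R" for x y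
    using assms(1) by (auto simp: simple_on_def sym_def)
  have irr: "(x, x) \<notin> R" for x
    using assms(1) by (auto simp: simple_on_def irrefl_def)
  have sub: "?X \<subseteq> R `` {u}" by (auto simp: private_nbs_def)
  then have finX: "finite ?X" using fin finite_subset by blast
  have "shift R u v `` {v} = R `` {v} \<union> ?X"
    using assms(2) by (auto simp: shift_def Let_def private_nbs_def)
  moreover have "R `` {v} \<inter> ?X = {}" by (auto simp: private_nbs_def)
  ultimately show "deg (shift R u v) v = deg R v + card ?X"
    using fin finX by (simp add: deg_def card_Un_disjoint)
  have "shift R u v `` {u} = R `` {u} - ?X"
    using assms(2) irr by (auto simp: shift_def Let_def private_nbs_def)
  then show "deg (shift R u v) u = deg R u - card ?X"
    using sub finX by (simp add: deg_def card_Diff_subset)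
  show "card ?X \<le> deg R u"
    using sub fin by (simp add: deg_def card_mono)
  show "deg (shift R u v) w = deg R w" if w: "w \<noteq> u" "w \<noteq> v"
  proof (cases "w \<in> ?X")
    case True
    \<comment> \<open>A moved neighbour trades \<open>u\<close> for \<open>v\<close>, which it did
      not have before, so its degree stays the same.\<close>
    have "shift R u v `` {w} = insert v (R `` {w} - {u})"
      using True w by (auto simp: shift_def Let_def private_nbs_def)
    moreover have "v \<notin> R `` {w} - {u}" "u \<in> R `` {w}"
      using True sym by (auto simp: private_nbs_def)
    ultimately show ?thesis
      using fin[of w] card_Suc_Diff1[of "R `` {w}" u] by (simp add: deg_def)
  next
    case False
    then have "shift R u v `` {w} = R `` {w}"
      using w by (auto simp: shift_def Let_def)
    then show ?thesis by (simp add: deg_def)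
  qed
qed

lemma sum_remove2:
  fixes f :: "'a \<Rightarrow> 'b::comm_monoid_add"
  assumes "finite V" "u \<in> V" "v \<in> V" "u \<noteq> v"
  shows "sum f V = f u + (f v + sum f (V - {u, v}))"
proof -
  have "sum f V = f u + sum f (V - {u})"
    using assms by (simp add: sum.remove)
  also have "sum f (V - {u}) = f v + sum f (V - {u} - {v})"
    using assms by (simp add: sum.remove)
  also have "V - {u} - {v} = V - {u, v}" by auto
  finally show ?thesis .
qed

lemma card_shift:
  assumes "simple_on V R" "u \<in> V" "v \<in> V" "u \<noteq> v"
  shows "card (shift R u v) = card R"
proof -
  have fin: "finite V" using assms(1) by (simp add: simple_on_def)
  have "(\<Sum>w\<in>V - {u, v}. deg (shift R u v) w) = (\<Sum>w\<in>V - {u, v}. deg R w)"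
    using deg_shift(4)[OF assms(1,4)] by (intro sum.cong) auto
  then have "(\<Sum>w\<in>V. deg (shift R u v) w) = (\<Sum>w\<in>V. deg R w)"
    unfolding sum_remove2[OF fin assms(2-4)]
    \<comment> \<open>The inequality \<open>deg_shift(3)\<close> makes the truncated subtraction at
      \<open>u\<close> exact, so the gain of \<open>v\<close> cancels the loss of
      \<open>u\<close>.\<close>
    using deg_shift(1-3)[OF assms(1,4)] by simp
  then show ?thesis
    using sum_deg[OF assms(1)] sum_deg[OF simple_on_shift[OF assms(1,3)]] by simp
qed

lemma sum_shift_ge:
  assumes "simple_on V R" "u \<in> V" "v \<in> V" "u \<noteq> v" "deg R u \<le> deg R v" "convex_seq g"
  shows "(\<Sum>w\<in>V. g (deg R w)) \<le> (\<Sum>w\<in>V. g (deg (shift R u v) w))"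
proof -
  have fin: "finite V" using assms(1) by (simp add: simple_on_def)
  have "(\<Sum>w\<in>V - {u, v}. g (deg (shift R u v) w)) = (\<Sum>w\<in>V - {u, v}. g (deg R w))"
    using deg_shift(4)[OF assms(1,4)] by (intro sum.cong) auto
  moreover have "g (deg R v) + g (deg R u)
      \<le> g (deg (shift R u v) v) + g (deg (shift R u v) u)"
    using convex_seq_spread[OF assms(6,5) deg_shift(3)[OF assms(1,4)]]
      deg_shift(1,2)[OF assms(1,4)] by simp
  ultimately show ?thesis
    unfolding sum_remove2[OF fin assms(2-4)] by simp
qed

text \<open>Only edges between \<open>u\<close> and its private neighbours disappear, and each is
  replaced by a detour through \<open>v\<close> along the surviving edge between \<open>u\<close>
  and \<open>v\<close>.\<close>

lemma shift_rtrancl_mono: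
  assumes "simple_on V R" "(v, u) \<in> R"
  shows "R\<^sup>* \<subseteq> (shift R u v)\<^sup>*"
proof -
  let ?S = "shift R u v"
  have sym: "(x, y) \<in> R \<Longrightarrow> (y, x) \<in> R" for x y
    using assms(1) by (auto simp: simple_on_def sym_def)
  have irr: "(x, x) \<notin> R" for x
    using assms(1) by (auto simp: simple_on_def irrefl_def)
  have vu: "(v, u) \<in> ?S" "(u, v) \<in> ?S"
    using assms(2) sym irr by (auto simp: shift_def Let_def private_nbs_def)
  have "(x, y) \<in> ?S\<^sup>*" if "(x, y) \<in> R" for x y
  proof (cases "(x, y) \<in> ?S")
    case False
    let ?X = "private_nbs R u v"
    have "(x = u \<and> y \<in> ?X) \<or> (y = u \<and> x \<in> ?X)"
      using that False by (auto simp: shift_def Let_def)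
    then show ?thesis
    proof
      assume "x = u \<and> y \<in> ?X"
      then have "(x, v) \<in> ?S" "(v, y) \<in> ?S"
        using vu by (auto simp: shift_def Let_def)
      then show ?thesis by (meson r_into_rtrancl rtrancl.rtrancl_into_rtrancl)
    next
      assume "y = u \<and> x \<in> ?X"
      then have "(x, v) \<in> ?S" "(v, y) \<in> ?S"
        using vu by (auto simp: shift_def Let_def)
      then show ?thesis by (meson r_into_rtrancl rtrancl.rtrancl_into_rtrancl)
    qed
  qed auto
  then have "R \<subseteq> ?S\<^sup>*" by auto
  then show ?thesis by (metis rtrancl_mono rtrancl_idemp)
qed

lemma rtrancl_leaves_set:
  assumes "(a, b) \<in> R\<^sup>*" "a \<in> A" "b \<notin> A"
  obtains x y where "(x, y) \<in> R" "x \<in> A" "y \<notin> A"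
  using assms by (induction rule: rtrancl_induct) blast+

section \<open>Absorption into one vertex, and its deletion\<close>

text \<open>Each shift raises the degree of \<open>v\<close>, which is bounded by
  \<open>card V\<close>, and raises no other degree, so \<open>v\<close> stays maximal. The range
  condition says that \<open>v\<close> dominates all non-isolated vertices. Reachability enters as
  an implication so that one induction serves both connected and disconnected graphs.\<close>

lemma exists_absorbed:
  assumes "simple_on V R" "v \<in> V" "\<And>u. u \<in> V \<Longrightarrow> deg R u \<le> deg R v" "convex_seq g"
  shows "\<exists>S. simple_on V S \<and> card S = card R
    \<and> (\<Sum>w\<in>V. g (deg R w)) \<le> (\<Sum>w\<in>V. g (deg S w))
    \<and> Range S \<subseteq> insert v (S `` {v})
    \<and> ((\<forall>w\<in>V. (v, w) \<in> R\<^sup>*) \<longrightarrow> (\<forall>w\<in>V. (v, w) \<in> S\<^sup>*))"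
  using assms(1,3)
proof (induction "card V - deg R v" arbitrary: R rule: less_induct)
  case less
  let ?N = "insert v (R `` {v})"
  show ?case
  proof (cases "Range R \<subseteq> ?N")
    case True
    then show ?thesis using less.prems by blast
  next
    case False
    then obtain u0 y0 where uy0: "(u0, y0) \<in> R" "y0 \<notin> ?N" by auto
    have RV: "x \<in> V \<and> y \<in> V" if "(x, y) \<in> R" for x y
      using less.prems(1) that by (auto simp: simple_on_def)
    \<comment> \<open>In the connected case a path from \<open>v\<close> to \<open>y0\<close> leaves
      the closed neighbourhood of \<open>v\<close> along some edge; its inner end is not
      \<open>v\<close> itself, hence a neighbour of \<open>v\<close>. Otherwise any edge leading
      outside will do.\<close>
    obtain u y where uy: "(u, y) \<in> R" "y \<notin> ?N" "(\<forall>w\<in>V. (v, w) \<in> R\<^sup>*) \<longrightarrow> (v, u) \<in> R"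
    proof (cases "\<forall>w\<in>V. (v, w) \<in> R\<^sup>*")
      case True
      then have "(v, y0) \<in> R\<^sup>*" using uy0 RV by auto
      then obtain x z where "(x, z) \<in> R" "x \<in> ?N" "z \<notin> ?N"
        using rtrancl_leaves_set[of v y0 R ?N] uy0(2) by blast
      then show thesis using that by blast
    next
      case False
      then show thesis using that uy0 by blast
    qed
    have ne: "u \<noteq> v" using uy by auto
    have uV: "u \<in> V" using uy RV by auto
    let ?S = "shift R u v" and ?X = "private_nbs R u v"
    have yX: "y \<in> ?X" using uy by (auto simp: private_nbs_def)
    have "finite ?X"
      using simple_on_finite_nbs[OF less.prems(1), of u] by (auto simp: private_nbs_def)
    then have pos: "0 < card ?X" using yX by (auto simp: card_gt_0_iff)
    note S = simple_on_shift[OF less.prems(1) assms(2), of u]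
    have lt: "deg R v < deg ?S v"
      using deg_shift(1)[OF less.prems(1) ne] pos by simp
    \<comment> \<open>Without this bound the truncated measure need not drop.\<close>
    moreover have "deg ?S v \<le> card V" using deg_le_card[OF S] .
    ultimately have dec: "card V - deg ?S v < card V - deg R v" by linarith
    have max: "deg ?S w \<le> deg ?S v" if "w \<in> V" for w
    proof -
      have "deg ?S w \<le> deg R w \<or> w = v"
        using deg_shift(2,4)[OF less.prems(1) ne] by (cases "w = u") auto
      then show ?thesis
        using less.prems(2)[OF that] lt by auto
    qed
    obtain T where T: "simple_on V T" "card T = card ?S"
      "(\<Sum>w\<in>V. g (deg ?S w)) \<le> (\<Sum>w\<in>V. g (deg T w))"
      "Range T \<subseteq> insert v (T `` {v})"
      "(\<forall>w\<in>V. (v, w) \<in> ?S\<^sup>*) \<longrightarrow> (\<forall>w\<in>V. (v, w) \<in> T\<^sup>*)"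
      using less.hyps[OF dec S max] by blast
    have "(\<Sum>w\<in>V. g (deg R w)) \<le> (\<Sum>w\<in>V. g (deg T w))"
      using sum_shift_ge[OF less.prems(1) uV assms(2) ne less.prems(2)[OF uV] assms(4)] T(3)
      by linarith
    moreover have "card T = card R"
      using T(2) card_shift[OF less.prems(1) uV assms(2) ne] by simp
    moreover have "(\<forall>w\<in>V. (v, w) \<in> R\<^sup>*) \<longrightarrow> (\<forall>w\<in>V. (v, w) \<in> T\<^sup>*)"
      using uy(3) T(5) shift_rtrancl_mono[OF less.prems(1), of v u] by blast
    ultimately show ?thesis using T(1,4) by blast
  qed
qed

text \<open>A neighbour of \<open>v\<close> has \<open>v\<close> and its neighbours inside
  \<open>N\<close>, whence the shift of \<open>g\<close> by one; vertices outside
  \<open>insert v N\<close> are isolated and contribute \<open>g 0\<close>.\<close>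

lemma absorbed_restrict:
  fixes g :: "nat \<Rightarrow> real"
  assumes "simple_on V R" "v \<in> V" "Range R \<subseteq> insert v (R `` {v})"
  defines "N \<equiv> R `` {v}"
  defines "Q \<equiv> R \<inter> N \<times> N"
  shows "simple_on N Q"
    and "(\<Sum>w\<in>V. g (deg R w)) = g (card N) + (\<Sum>w\<in>N. g (Suc (deg Q w)))
           + (real (card V) - 1 - real (card N)) * g 0"
    and "card R = card Q + 2 * card N"
    and "card N < card V"
proof -
  have sym: "(x, y) \<in> R \<Longrightarrow> (y, x) \<in> R" for x y
    using assms(1) by (auto simp: simple_on_def sym_def)
  have irr: "(x, x) \<notin> R" for x
    using assms(1) by (auto simp: simple_on_def irrefl_def)
  have fV: "finite V" using assms(1) by (simp add: simple_on_def)
  have vN: "v \<notin> N" and NV: "N \<subseteq> V"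
    using irr assms(1) by (auto simp: N_def simple_on_def)
  have fN: "finite N" using fV NV finite_subset by auto
  show Q: "simple_on N Q"
    using fN sym irr by (auto simp: simple_on_def Q_def sym_def irrefl_def)
  have degN: "deg R w = Suc (deg Q w)" if "w \<in> N" for w
  proof -
    have "R `` {w} = insert v (Q `` {w})"
      using that assms(3) sym by (auto simp: N_def Q_def)
    moreover have "v \<notin> Q `` {w}" using vN by (auto simp: Q_def)
    ultimately show ?thesis
      using simple_on_finite_nbs[OF Q] by (simp add: deg_def)
  qed
  have deg0: "deg R w = 0" if "w \<in> V - insert v N" for w
  proof -
    have "R `` {w} = {}"
      using that assms(3) sym by (auto simp: N_def)
    then show ?thesis by (simp add: deg_def)
  qed
  have degv: "deg R v = card N" by (simp add: deg_def N_def)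
  have split: "sum f V = f v + sum f N + sum f (V - insert v N)" for f :: "'a \<Rightarrow> 'c::comm_monoid_add"
  proof -
    have "sum f V = sum f (V - insert v N) + sum f (insert v N)"
      using fV NV assms(2) by (intro sum.subset_diff) auto
    then show ?thesis using fN vN by (simp add: add_ac)
  qed
  have cardR: "card (V - insert v N) = card V - Suc (card N)"
    using fN vN NV assms(2) by (simp add: card_Diff_subset)
  have "card (insert v N) \<le> card V"
    using fV NV assms(2) by (intro card_mono) auto
  then show le: "card N < card V"
    using fN vN by simp
  have "(\<Sum>w\<in>V. g (deg R w)) = g (card N) + (\<Sum>w\<in>N. g (Suc (deg Q w)))
      + (\<Sum>w\<in>V - insert v N. g 0)"
    unfolding split[of "\<lambda>w. g (deg R w)"] using degN deg0 degv by simp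
  then show "(\<Sum>w\<in>V. g (deg R w)) = g (card N) + (\<Sum>w\<in>N. g (Suc (deg Q w)))
           + (real (card V) - 1 - real (card N)) * g 0"
    using le by (simp add: cardR of_nat_diff)
  \<comment> \<open>The same splitting with the identity for \<open>g\<close> counts arcs: those at
    \<open>v\<close> are counted once at \<open>v\<close> and once at its neighbours.\<close>
  have "(\<Sum>w\<in>V. deg R w) = card N + (\<Sum>w\<in>N. Suc (deg Q w))"
    unfolding split[of "\<lambda>w. deg R w"] using degN deg0 degv by simp
  also have "(\<Sum>w\<in>N. Suc (deg Q w)) = card N + card Q"
    using sum_deg[OF Q] by (simp add: sum_Suc)
  finally show "card R = card Q + 2 * card N"
    using sum_deg[OF assms(1)] by simp
qed

section \<open>Threshold graphs and the upper bound\<close>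

text \<open>Sum of \<open>g\<close> over the degrees of the threshold graph on \<open>n\<close> vertices in which one vertex has \<open>a\<close>
  neighbours, these neighbours span the threshold graph given by the remaining parts, and the other
  vertices are isolated.\<close>

fun threshold_sum :: "nat list \<Rightarrow> (nat \<Rightarrow> real) \<Rightarrow> nat \<Rightarrow> real" where
  "threshold_sum [] g n = real n * g 0"
| "threshold_sum (a # p) g n =
     g a + threshold_sum p (\<lambda>k. g (Suc k)) a + (real n - 1 - real a) * g 0"

definition strict_partition :: "nat \<Rightarrow> nat list \<Rightarrow> bool" where
  "strict_partition e p \<longleftrightarrow> sorted_wrt (>) p \<and> 0 \<notin> set p \<and> sum_list p = e"

lemma exists_max_deg:
  assumes "simple_on V R" "V \<noteq> {}"
  obtains v where "v \<in> V" "\<And>u. u \<in> V \<Longrightarrow> deg R u \<le> deg R v"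
proof -
  have "finite V" using assms(1) by (simp add: simple_on_def)
  then have "Max (deg R ` V) \<in> deg R ` V" using assms(2) by (intro Max_in) auto
  then obtain v where "v \<in> V" "deg R v = Max (deg R ` V)" by auto
  then show thesis using that \<open>finite V\<close> by (metis Max_ge finite_imageI imageI)
qed

text \<open>Absorb into a vertex of maximum degree, split off its \<open>card N\<close> edges as the
  first part and recurse into \<open>N\<close>. The clause \<open>a < card V\<close> makes the parts
  strictly decrease, since the next vertex set is \<open>N\<close>.\<close>

lemma sum_deg_le_threshold_sum:
  assumes "simple_on V R" "card R = 2 * e" "convex_seq g"
  shows "\<exists>p. strict_partition e p \<and> (\<forall>a\<in>set p. a < card V)
    \<and> (\<Sum>w\<in>V. g (deg R w)) \<le> threshold_sum p g (card V)"
  using assms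
proof (induction e arbitrary: V R g rule: less_induct)
  case (less e)
  show ?case
  proof (cases "e = 0")
    case True
    then have "R = {}" using less.prems(2) simple_on_finite[OF less.prems(1)] by simp
    then have "(\<Sum>w\<in>V. g (deg R w)) = threshold_sum [] g (card V)"
      by (simp add: deg_def)
    then show ?thesis
      using True by (intro exI[of _ "[]"]) (simp add: strict_partition_def)
  next
    case False
    then have "R \<noteq> {}" using less.prems(2) by auto
    then have "V \<noteq> {}" using less.prems(1) by (auto simp: simple_on_def)
    then obtain v where v: "v \<in> V" "\<And>u. u \<in> V \<Longrightarrow> deg R u \<le> deg R v"
      using exists_max_deg[OF less.prems(1)] by blast
    obtain S where S: "simple_on V S" "card S = card R"
      "(\<Sum>w\<in>V. g (deg R w)) \<le> (\<Sum>w\<in>V. g (deg S w))"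
      "Range S \<subseteq> insert v (S `` {v})"
      using exists_absorbed[OF less.prems(1) v less.prems(3)] by blast
    define N where "N = S `` {v}"
    define Q where "Q = S \<inter> N \<times> N"
    note res = absorbed_restrict[OF S(1) v(1) S(4), folded N_def, folded Q_def]
    \<comment> \<open>As edges remain, the new part is positive and the edge count drops.\<close>
    have "N \<noteq> {}"
    proof
      assume "N = {}"
      then have "S = {}"
        using S(1,4) unfolding N_def simple_on_def sym_def by fastforce
      then show False using S(2) less.prems(2) False by simp
    qed
    then have N0: "0 < card N"
      using res(1) by (simp add: card_gt_0_iff simple_on_def)
    have cQ: "card Q = 2 * (e - card N)" and le: "card N \<le> e"
      using res(3) S(2) less.prems(2) by auto
    obtain p where p: "strict_partition (e - card N) p" "\<forall>a\<in>set p. a < card N"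
      "(\<Sum>w\<in>N. g (Suc (deg Q w))) \<le> threshold_sum p (\<lambda>k. g (Suc k)) (card N)"
      using less.IH[OF _ res(1) cQ convex_seq_Suc[OF less.prems(3)]] N0 False by auto
    have "strict_partition e (card N # p)"
      using p(1,2) N0 le by (auto simp: strict_partition_def)
    moreover have "\<forall>a\<in>set (card N # p). a < card V"
      using p(2) res(4) by auto
    moreover have "(\<Sum>w\<in>V. g (deg R w)) \<le> threshold_sum (card N # p) g (card V)"
      using S(3) p(3) res(2)[of g] by simp
    ultimately show ?thesis by blast
  qed
qed

text \<open>Connectivity forces the first part to be \<open>card V - 1\<close>; deleting the
  dominating vertex leaves \<open>c\<close> edges on a possibly disconnected graph.\<close>

lemma connected_sum_deg_le_threshold_sum:
  assumes "simple_on V R" "V \<noteq> {}" "\<And>u w. u \<in> V \<Longrightarrow> w \<in> V \<Longrightarrow> (u, w) \<in> R\<^sup>*"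
    "card R = 2 * (card V - 1 + c)" "convex_seq g"
  shows "\<exists>p. strict_partition c p
    \<and> (\<Sum>w\<in>V. g (deg R w)) \<le> threshold_sum ((card V - 1) # p) g (card V)"
proof -
  obtain v where v: "v \<in> V" "\<And>u. u \<in> V \<Longrightarrow> deg R u \<le> deg R v"
    using exists_max_deg[OF assms(1,2)] by blast
  obtain S where S: "simple_on V S" "card S = card R"
    "(\<Sum>w\<in>V. g (deg R w)) \<le> (\<Sum>w\<in>V. g (deg S w))"
    "Range S \<subseteq> insert v (S `` {v})" "\<forall>w\<in>V. (v, w) \<in> S\<^sup>*"
    using exists_absorbed[OF assms(1) v assms(5)] assms(3) v(1) by blast
  define N where "N = S `` {v}"
  define Q where "Q = S \<inter> N \<times> N"
  note res = absorbed_restrict[OF S(1) v(1) S(4), folded N_def, folded Q_def]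
  \<comment> \<open>A vertex other than \<open>v\<close> that is reachable from \<open>v\<close> is
    the target of an arc, so it lies in \<open>Range S\<close>.\<close>
  have "V \<subseteq> insert v N"
  proof
    fix w assume "w \<in> V"
    then have "(v, w) \<in> S\<^sup>*" using S(5) by blast
    then show "w \<in> insert v N"
      by (cases rule: rtranclE) (use S(4) in \<open>auto simp: N_def\<close>)
  qed
  moreover have "finite N" using res(1) by (simp add: simple_on_def)
  ultimately have "card V \<le> Suc (card N)"
    by (metis card_insert_le_m1 card_mono finite_insert card_insert_if le_trans le_SucI order_refl)
  then have N: "card N = card V - 1" using res(4) by linarith
  have cQ: "card Q = 2 * c" using res(3) S(2) assms(4) N by simp
  obtain p where p: "strict_partition c p"
      "(\<Sum>w\<in>N. g (Suc (deg Q w))) \<le> threshold_sum p (\<lambda>k. g (Suc k)) (card N)"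
    using sum_deg_le_threshold_sum[OF res(1) cQ convex_seq_Suc[OF assms(5)]] by blast
  have "(\<Sum>w\<in>V. g (deg R w)) \<le> threshold_sum (card N # p) g (card V)"
    using S(3) p(2) res(2)[of g] by simp
  then show ?thesis using p(1) N by auto
qed

section \<open>The lower bound\<close>

lemma tangent_sum_deg:
  assumes "simple_on V R" "convex_seq g"
  shows "real (card V) * g 2 + (real (card R) - 2 * real (card V)) * (g 3 - g 2)
    \<le> (\<Sum>w\<in>V. g (deg R w))"
proof -
  have "(\<Sum>w\<in>V. g 2 + (real (deg R w) - 2) * (g 3 - g 2)) \<le> (\<Sum>w\<in>V. g (deg R w))"
    using convex_seq_tangent[OF assms(2), of 2] by (intro sum_mono) (simp add: numeral_eq_Suc)
  moreover have "(\<Sum>w\<in>V. g 2 + (real (deg R w) - 2) * (g 3 - g 2))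
      = real (card V) * g 2 + ((\<Sum>w\<in>V. real (deg R w)) - 2 * real (card V)) * (g 3 - g 2)"
    by (simp add: sum.distrib sum_subtractf flip: sum_distrib_right)
  moreover have "(\<Sum>w\<in>V. real (deg R w)) = real (card R)"
    using sum_deg[OF assms(1)] by (simp flip: of_nat_sum)
  ultimately show ?thesis by simp
qed

section \<open>Partitions of small numbers into distinct parts\<close>

lemma strict_partitions_le_6:
  assumes "strict_partition c p" "1 \<le> c" "c \<le> 6"
  shows "p = [c] \<or> (c = 3 \<and> p = [2, 1]) \<or> (c = 4 \<and> p = [3, 1])
    \<or> (c = 5 \<and> p \<in> {[4, 1], [3, 2]}) \<or> (c = 6 \<and> p \<in> {[5, 1], [4, 2], [3, 2, 1]})"
proof (cases p)
  case Nil
  then show ?thesis using assms by (simp add: strict_partition_def)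
next
  case (Cons x q)
  show ?thesis
  proof (cases q)
    case Nil
    then show ?thesis using assms Cons by (simp add: strict_partition_def)
  next
    case q: (Cons y r)
    show ?thesis
    proof (cases r)
      case Nil
      then show ?thesis using assms Cons q by (simp add: strict_partition_def) presburger
    next
      case r: (Cons z s)
      show ?thesis
      proof (cases s)
        case Nil
        then show ?thesis using assms Cons q r by (simp add: strict_partition_def)
      next
        \<comment> \<open>Four distinct positive parts already sum to at least 10.\<close>
        case (Cons t s')
        then show ?thesis using assms \<open>p = x # q\<close> q r
          by (simp add: strict_partition_def)
      qed
    qed
  qed
qed

section \<open>Power sequences and the explicit bounds\<close>

text \<open>The value 2 at 0 keeps the sequence convex there for either sign; no vertex has degree 0.\<close>

definition signed_powr_seq :: "real \<Rightarrow> real \<Rightarrow> nat \<Rightarrow> real" where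
  "signed_powr_seq s \<alpha> k = (if k = 0 then 2 else s * real k powr \<alpha>)"

lemma signed_powr_seq_pos [simp]:
  "0 < k \<Longrightarrow> signed_powr_seq s \<alpha> k = s * real k powr \<alpha>"
  by (simp add: signed_powr_seq_def)

text \<open>The factor \<open>s\<close> has the sign of the second derivative, so that the concave
  range of \<alpha> is handled together with the convex one.\<close>

lemma convex_on_signed_powr:
  assumes "0 \<le> s * (\<alpha> * (\<alpha> - 1))"
  shows "convex_on {0<..} (\<lambda>x::real. s * x powr \<alpha>)"
proof (rule f''_ge0_imp_convex)
  show "((\<lambda>x. s * x powr \<alpha>) has_real_derivative s * (\<alpha> * x powr (\<alpha> - 1))) (at x)"
    if "x \<in> {0<..}" for x
    using that by (auto intro!: derivative_eq_intros)
  show "((\<lambda>x. s * (\<alpha> * x powr (\<alpha> - 1))) has_real_derivative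
      (s * (\<alpha> * (\<alpha> - 1))) * x powr (\<alpha> - 2)) (at x)"
    if "x \<in> {0<..}" for x
    using that by (auto intro!: derivative_eq_intros)
  show "0 \<le> s * (\<alpha> * (\<alpha> - 1)) * x powr (\<alpha> - 2)" for x
    using assms by simp
qed auto

lemma convex_signed_powr_seq:
  assumes "(s = 1 \<and> (\<alpha> < 0 \<or> \<alpha> > 1)) \<or> (s = -1 \<and> 0 < \<alpha> \<and> \<alpha> < 1)"
  shows "convex_seq (signed_powr_seq s \<alpha>)"
  unfolding convex_seq_def
proof
  fix k
  show "2 * signed_powr_seq s \<alpha> (Suc k)
      \<le> signed_powr_seq s \<alpha> k + signed_powr_seq s \<alpha> (Suc (Suc k))"
  proof (cases k)
    case 0
    \<comment> \<open>At 0 the claim is \<open>2 * s <= 2 + s * 2 powr \<alpha>\<close>. For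
      \<open>s = 1\<close> it is clear; for \<open>s = -1\<close> it asks for
      \<open>2 powr \<alpha> <= 4\<close>.\<close>
    have "2 powr \<alpha> \<le> 2 powr 1" if "\<alpha> < 1"
      using that by (intro powr_mono) auto
    then show ?thesis
      using assms 0 by (auto simp: signed_powr_seq_def)
  next
    case (Suc j)
    have "0 \<le> s * (\<alpha> * (\<alpha> - 1))"
      using assms by (auto simp: zero_le_mult_iff mult_le_0_iff)
    from convex_onD[OF convex_on_signed_powr[OF this], of "1/2" "real k" "real k + 2"]
    have "s * ((1/2) * real k + (1/2) * (real k + 2)) powr \<alpha>
        \<le> (1/2) * (s * real k powr \<alpha>) + (1/2) * (s * (real k + 2) powr \<alpha>)"
      using Suc by simp
    moreover have "(1/2) * real k + (1/2) * (real k + 2) = real k + 1"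
      by (simp add: field_simps)
    ultimately have "2 * (s * (real k + 1) powr \<alpha>) \<le> s * real k powr \<alpha> + s * (real k + 2) powr \<alpha>"
      by simp
    then show ?thesis
      using Suc by (simp add: add_ac)
  qed
qed

text \<open>The first part \<open>n - 1\<close> leaves no isolated vertex and all later sequences
  are shifted, so the value at 0 drops out. For example, \<open>[3, 2, 1]\<close> is a complete
  graph on four vertices below the dominating one, giving
  \<open>2 powr (2 * \<alpha> + 2)\<close>.\<close>

lemma threshold_sum_in_U_set:
  assumes "strict_partition c p" "1 \<le> c" "c \<le> 6" "n \<ge> c + 2"
  shows "\<exists>u\<in>U_set c n \<alpha>.
    threshold_sum ((n - 1) # p) (signed_powr_seq s \<alpha>) n = s * u"
proof -
  \<comment> \<open>\<open>U_set\<close> writes the powers of 4 in several ways; these equations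
    bring them to one form.\<close>
  have four: "(4::real) powr \<alpha> = 2 powr \<alpha> * 2 powr \<alpha>" "2 powr (\<alpha> * 2) = 2 powr \<alpha> * (2::real) powr \<alpha>"
    using powr_mult[of 2 2 \<alpha>] powr_add[of 2 \<alpha> \<alpha>] by (simp_all add: mult.commute)
  consider "c = 1" | "c = 2" | "c = 3" | "c = 4" | "c = 5" | "c = 6"
    using assms(2,3) by linarith
  then show ?thesis
    using strict_partitions_le_6[OF assms(1-3)] assms(4)
    by cases (auto simp: U_set_def of_nat_diff powr_add four algebra_simps)
qed

section \<open>Translation from library graphs to relations\<close>

lemma card_undirected_edges:
  assumes "finite (parcs G)" "sym (parcs G)" "irrefl (parcs G)"
  shows "card (parcs G) = 2 * card (undirected_edges G)"
proof -
  let ?R = "parcs G" and ?f = "\<lambda>(u, v). {u, v}"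
  have E: "undirected_edges G = ?f ` ?R"
    by (auto simp: undirected_edges_def)
  have "card {r \<in> ?R. ?f r = e} = 2" if e: "e \<in> undirected_edges G" for e
  proof -
    obtain u v where uv: "(u, v) \<in> ?R" "e = {u, v}"
      using e by (auto simp: undirected_edges_def)
    then have "u \<noteq> v" "(v, u) \<in> ?R"
      using assms by (auto simp: sym_def irrefl_def)
    then have "{r \<in> ?R. ?f r = e} = {(u, v), (v, u)}"
      using uv by (auto simp: doubleton_eq_iff)
    then show ?thesis using \<open>u \<noteq> v\<close> by simp
  qed
  then have "(\<Sum>e\<in>undirected_edges G. card {r \<in> ?R. ?f r = e}) = 2 * card (undirected_edges G)"
    by simp
  moreover have "card ?R = (\<Sum>e\<in>?f ` ?R. card {r \<in> ?R. ?f r = e})"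
    using sum.image_gen[OF assms(1), of "\<lambda>_. 1::nat" ?f] by simp
  ultimately show ?thesis using E by simp
qed

text \<open>The library defines connectedness as strong connectedness of the symmetric closure,
  which here adds no arcs.\<close>

lemma connected_simple_graphD:
  assumes "connected_simple_graph G"
  shows "simple_on (pverts G) (parcs G)" "pverts G \<noteq> {}"
    "\<And>u w. u \<in> pverts G \<Longrightarrow> w \<in> pverts G \<Longrightarrow> (u, w) \<in> (parcs G)\<^sup>*"
proof -
  interpret pair_graph G using assms by (simp add: connected_simple_graph_def)
  have con: "strongly_connected (with_proj (mk_symmetric (with_proj G)))"
    using assms by (simp add: connected_simple_graph_def Digraph_Component.connected_def)
  have sym: "sym (parcs G)" using arcs_symmetric by (auto simp: sym_def)
  then show "simple_on (pverts G) (parcs G)"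
    using pair_finite_verts in_arcsD1 in_arcsD2 no_loops'
    unfolding simple_on_def irrefl_def by (metis mem_Sigma_iff subrelI)
  show "pverts G \<noteq> {}"
    using con by (simp add: strongly_connected_def)
  have arcs: "parcs (mk_symmetric (with_proj G)) = parcs G"
    using sym by (auto simp: mk_symmetric_def sym_def)
  show "(u, w) \<in> (parcs G)\<^sup>*" if "u \<in> pverts G" "w \<in> pverts G" for u w
  proof -
    have "u \<rightarrow>\<^sup>*\<^bsub>with_proj (mk_symmetric (with_proj G))\<^esub> w"
      using con that by (auto simp: strongly_connected_def)
    then show ?thesis
      by (auto simp: reachable_def arcs dest: rtrancl_on_rtranclI)
  qed
qed

lemma out_degree_eq_deg: "out_degree (with_proj G) v = deg (parcs G) v"
proof -
  have "out_arcs (with_proj G) v = Pair v ` (parcs G `` {v})"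
    by (auto simp: out_arcs_def)
  then show ?thesis
    by (simp add: out_degree_def deg_def card_image inj_on_def)
qed

text \<open>This is the tangent bound: \<open>n\<close> vertices at degree 2, plus
  \<open>2 * (c - 1)\<close> increments from 2 to 3 for the excess of the degree sum over
  \<open>2 * n\<close>.\<close>

lemma L_bound_eq:
  assumes "1 \<le> c" "c \<le> 6"
  shows "L_bound c n \<alpha> = real n * 2 powr \<alpha> + 2 * (real c - 1) * (3 powr \<alpha> - 2 powr \<alpha>)"
proof -
  consider "c = 1" | "c = 2" | "c = 3" | "c = 4" | "c = 5" | "c = 6"
    using assms by linarith
  then show ?thesis
    by cases (simp_all add: L_bound_def powr_add algebra_simps)
qed

section \<open>Bounds for both ranges of the exponent\<close>

lemma signed_zagreb_bounds:
  assumes c: "1 \<le> c" "c \<le> 6" and n: "n \<ge> c + 2"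
    and G: "connected_simple_graph G" and card: "card (pverts G) = n" and cyc: "c_cyclic c G"
    and s: "(s = 1 \<and> (\<alpha> < 0 \<or> \<alpha> > 1)) \<or> (s = -1 \<and> 0 < \<alpha> \<and> \<alpha> < 1)"
  shows "s * L_bound c n \<alpha> \<le> s * first_general_zagreb \<alpha> G"
    and "\<exists>u\<in>U_set c n \<alpha>. s * first_general_zagreb \<alpha> G \<le> s * u"
proof -
  let ?V = "pverts G" and ?R = "parcs G" and ?g = "signed_powr_seq s \<alpha>"
  note simple = connected_simple_graphD(1)[OF G]
  note conn = connected_simple_graphD(2,3)[OF G]
  have "card ?R = 2 * card (undirected_edges G)"
    using simple simple_on_finite[OF simple]
    by (intro card_undirected_edges) (auto simp: simple_on_def)
  then have cR: "card ?R = 2 * (card ?V - 1 + c)"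
    using cyc n card by (simp add: c_cyclic_def)
  \<comment> \<open>A connected graph with at least two vertices has no isolated vertex, so the
    artificial value at 0 never enters the index.\<close>
  have pos: "0 < deg ?R v" if v: "v \<in> ?V" for v
  proof -
    have "\<not> ?V \<subseteq> {v}"
      using card n card_mono[of "{v}" ?V] by auto
    then obtain w where w: "w \<in> ?V" "w \<noteq> v" by auto
    have "(v, w) \<in> ?R\<^sup>*" using conn(2) v w by blast
    then obtain x where "(v, x) \<in> ?R"
      using w(2) by (metis converse_rtranclE)
    then have "?R `` {v} \<noteq> {}" by blast
    then show ?thesis
      using simple_on_finite_nbs[OF simple] by (simp add: deg_def card_gt_0_iff)
  qed
  have Z: "(\<Sum>v\<in>?V. ?g (deg ?R v)) = s * first_general_zagreb \<alpha> G"
    unfolding first_general_zagreb_def sum_distrib_left out_degree_eq_deg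
    using pos by (intro sum.cong) auto
  note conv = convex_signed_powr_seq[OF s]
  have excess: "real (card ?R) - 2 * real n = 2 * (real c - 1)"
    using cR card n by (simp add: of_nat_diff)
  show "s * L_bound c n \<alpha> \<le> s * first_general_zagreb \<alpha> G"
    using tangent_sum_deg[OF simple conv]
    unfolding Z L_bound_eq[OF c] card excess by (simp add: algebra_simps)
  obtain p where p: "strict_partition c p"
    "(\<Sum>w\<in>?V. ?g (deg ?R w)) \<le> threshold_sum ((n - 1) # p) ?g n"
    using connected_sum_deg_le_threshold_sum[OF simple conn cR conv] card by auto
  then show "\<exists>u\<in>U_set c n \<alpha>. s * first_general_zagreb \<alpha> G \<le> s * u"
    using threshold_sum_in_U_set[OF p(1) c n, of \<alpha> s] unfolding Z by auto
qed

lemma finite_U_set: "1 \<le> c \<Longrightarrow> c \<le> 6 \<Longrightarrow> finite (U_set c n \<alpha>)"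
  by (auto simp: U_set_def)

theorem mainTheorem3:
  fixes G :: "'a pair_pre_digraph" and c n :: nat and \<alpha> :: real
  assumes "1 \<le> c" and "c \<le> 6" and "n \<ge> c + 2"
    and "\<alpha> \<noteq> 0" and "\<alpha> \<noteq> 1"
    and "connected_simple_graph G" and "card (pverts G) = n" and "c_cyclic c G"
  shows "(\<alpha> < 0 \<or> \<alpha> > 1 \<longrightarrow>
            L_bound c n \<alpha> \<le> first_general_zagreb \<alpha> G \<and>
            first_general_zagreb \<alpha> G \<le> Max (U_set c n \<alpha>)) \<and>
         (0 < \<alpha> \<and> \<alpha> < 1 \<longrightarrow>
            Min (U_set c n \<alpha>) \<le> first_general_zagreb \<alpha> G \<and>
            first_general_zagreb \<alpha> G \<le> L_bound c n \<alpha>)"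
proof (intro conjI impI)
  note fin = finite_U_set[OF assms(1,2), of n \<alpha>]
  note bounds = signed_zagreb_bounds[OF assms(1-3,6-8)]
  {
    assume a: "\<alpha> < 0 \<or> \<alpha> > 1"
    show "L_bound c n \<alpha> \<le> first_general_zagreb \<alpha> G"
      using bounds(1)[of 1 \<alpha>] a by simp
    obtain u where "u \<in> U_set c n \<alpha>" "first_general_zagreb \<alpha> G \<le> u"
      using bounds(2)[of 1 \<alpha>] a by auto
    then show "first_general_zagreb \<alpha> G \<le> Max (U_set c n \<alpha>)"
      using Max_ge[OF fin] by (meson order_trans)
  }
  {
    \<comment> \<open>Here \<open>s = -1\<close>, which reverses both inequalities and turns the
      maximum into a minimum.\<close>
    assume a: "0 < \<alpha> \<and> \<alpha> < 1"
    show "first_general_zagreb \<alpha> G \<le> L_bound c n \<alpha>"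
      using bounds(1)[of "-1" \<alpha>] a by simp
    obtain u where "u \<in> U_set c n \<alpha>" "u \<le> first_general_zagreb \<alpha> G"
      using bounds(2)[of "-1" \<alpha>] a by auto
    then show "Min (U_set c n \<alpha>) \<le> first_general_zagreb \<alpha> G"
      using Min_le[OF fin] by (meson order_trans)
  }
qed

end
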